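(* Let $a,b,c,\alpha,\beta,\gamma$ be integers with $0\le\alpha<a$, $0\le\beta<b$, $0\le\gamma<c$ and at most one of $\alpha,\beta,\gamma$ zero. Suppose $a+b+c+\alpha+\beta+\gamma\equiv 0\pmod 3$, put $s=\frac13(a+b+c+\alpha+\beta+\gamma)-2$, $A=s+2-a$, $B=s+2-b$, $C=s+2-c$, $M=s+2-(\alpha+\beta+\gamma)$, and assume $0\le M$, $0\le A\le\beta+\gamma$, $0\le B\le\alpha+\gamma$, $0\le C\le\alpha+\beta$. Then the enumeration of signed lozenge tilings of the punctured hexagon $H_{a,b,c,\alpha,\beta,\gamma}$, with signs given by the signs of the associated families of non-intersecting lattice paths, is $\det N_{a,b,c,\alpha,\beta,\gamma}$; that is, $$\sum_{T}\operatorname{sgn}(\lambda_T)=\det N_{a,b,c,\alpha,\beta,\gamma},$$ where the sum runs over all lozenge tilings $T$ of $H_{a,b,c,\alpha,\beta,\gamma}$ and $\lambda_T\in\mathfrak S_{C+M}$ is the permutation of the family of non-intersecting lattice paths associated to $T$.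
   Context: Region. Use coordinates $(u,v,w)$, $u,v,w\ge0$, $u+v+w=s+2$, on an equilateral triangle of side-length $s+2$ (vertex $v=w=0$ at the lower-center, $u=w=0$ at the upper right, $u=v=0$ at the upper left), tiled by unit triangles cut out by the lines $u,v,w\in\mathbb Z$. $H_{a,b,c,\alpha,\beta,\gamma}$ is the region obtained by keeping the points with $u\le a$, $v\le b$, $w\le c$ and removing the triangular puncture $\{u\ge\alpha,v\ge\beta,w\ge\gamma\}$ of side-length $M$; it is a union of unit triangles, and is a hexagon with side-lengths $(A,B+M,C,A+M,B,C+M)$ (clockwise from the bottom) with a triangular hole of side $M$. A lozenge is the union of two unit triangles sharing an edge; a lozenge tiling covers the region by lozenges with disjoint interiors. Lattice paths. Mark the midpoints of all unit edges in the region lying on lines $w=\text{const}$ (parallel to the sides of length $C$ and $C+M$). Label, in order of increasing $v$: the midpoints on the hexagon side $w=c$ as $A_1,\dots,A_C$ (so $A_i$ has $v=i-\frac12$); the midpoints on the puncture side $w=\gamma$ as $A_{C+1},\dots,A_{C+M}$ (so $A_{C+i}$ has $v=\beta+i-\frac12$); the midpoints on the hexagon side $w=0$ as $E_1,\dots,E_{C+M}$ (so $E_j$ has $v=A+j-\frac12$). Given a lozenge tiling $T$, connect two marked midpoints whenever they lie on opposite edges of the boundary of a single lozenge of $T$. This yields a family of $C+M$ non-intersecting paths, each starting at some $A_i$ and ending at some $E_j$; $\lambda_T\in\mathfrak S_{C+M}$ is the permutation such that $A_i$ is connected to $E_{\lambda_T(i)}$, and the sign of the family is the signature $\operatorname{sgn}(\lambda_T)$.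 Matrix. $N_{a,b,c,\alpha,\beta,\gamma}$ is the $(C+M)\times(C+M)$ integer matrix with $(i,j)$ entry $\binom{c}{A+j-i}$ if $1\le i\le C$ and $\binom{\gamma}{A+C-\beta+j-i}$ if $C+1\le i\le C+M$, where $\binom nk=0$ if $k<0$ or $k>n$ (determinant of the empty matrix is $1$). *)

theory Defs
  imports
    "HOL-Library.Disjoint_Sets"
    "HOL-Combinatorics.Permutations"
    "Jordan_Normal_Form.Determinant"
begin

text \<open>
  A lattice point is a triple of integers \<open>(u, v, w)\<close> with \<open>u + v + w = s + 2\<close>. A unit triangle is
  represented by the set of its three vertices, a unit edge (and with it its midpoint) by the set of
  its two endpoints, and a region that is a union of unit triangles by the set of these triangles.
\<close>

type_synonym point = "int \<times> int \<times> int"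
type_synonym edge = "point set"
type_synonym triangle = "point set"

text \<open>
  The lines \<open>u = i\<close>, \<open>v = j\<close>, \<open>w = k\<close> bound a unit triangle when \<open>i + j + k = s + 1\<close>; this is
  \<open>{u \<ge> i, v \<ge> j, w \<ge> k}\<close> (same orientation as the large triangle). Those of the opposite
  orientation are \<open>{u \<le> i + 1, v \<le> j + 1, w \<le> k + 1}\<close> with \<open>i + j + k = s\<close>.
\<close>

definition unit_triangles :: "int \<Rightarrow> triangle set" where
  "unit_triangles s =
     {{(i + 1, j, k), (i, j + 1, k), (i, j, k + 1)} | i j k. i + j + k = s + 1} \<union>
     {{(i, j + 1, k + 1), (i + 1, j, k + 1), (i + 1, j + 1, k)} | i j k. i + j + k = s}"

definition tri_edges :: "triangle \<Rightarrow> edge set" where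
  "tri_edges t = {e. e \<subseteq> t \<and> card e = 2}"

text \<open>
  Both the hexagon and the puncture are convex, so a unit triangle lies in one of them iff its
  vertices do.
\<close>

definition punctured_hexagon ::
  "int \<Rightarrow> int \<Rightarrow> int \<Rightarrow> int \<Rightarrow> int \<Rightarrow> int \<Rightarrow> int \<Rightarrow> triangle set" where
  "punctured_hexagon s a b c \<alpha> \<beta> \<gamma> =
     {t \<in> unit_triangles s.
        (\<forall>(u, v, w) \<in> t. 0 \<le> u \<and> 0 \<le> v \<and> 0 \<le> w \<and> u \<le> a \<and> v \<le> b \<and> w \<le> c) \<and>
        \<not> (\<forall>(u, v, w) \<in> t. \<alpha> \<le> u \<and> \<beta> \<le> v \<and> \<gamma> \<le> w)}"

definition lozenges :: "int \<Rightarrow> triangle set set" where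
  "lozenges s = {{t, t'} | t t'. t \<in> unit_triangles s \<and> t' \<in> unit_triangles s \<and>
                    t \<noteq> t' \<and> tri_edges t \<inter> tri_edges t' \<noteq> {}}"

definition lozenge_tilings :: "int \<Rightarrow> triangle set \<Rightarrow> triangle set set set" where
  "lozenge_tilings s R = {T. T \<subseteq> lozenges s \<and> partition_on R T}"

definition boundary_edges :: "triangle set \<Rightarrow> edge set" where
  "boundary_edges L = {e. \<exists>!t. t \<in> L \<and> e \<in> tri_edges t}"

definition marked :: "edge \<Rightarrow> bool" where
  "marked e \<longleftrightarrow> (\<exists>k. \<forall>(u, v, w) \<in> e. w = k)"

text \<open>
  Two different sides of a rhombus are opposite iff they have no vertex in common.
\<close>

definition path_steps :: "triangle set set \<Rightarrow> (edge \<times> edge) set" where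
  "path_steps T = {(e, e'). \<exists>L \<in> T. e \<in> boundary_edges L \<and> e' \<in> boundary_edges L \<and>
                     e \<inter> e' = {} \<and> marked e \<and> marked e'}"

text \<open>
  The unit edge on the line \<open>w = k\<close> whose midpoint has \<open>v = j - 1/2\<close>.
\<close>

definition w_edge :: "int \<Rightarrow> int \<Rightarrow> int \<Rightarrow> edge" where
  "w_edge s k j = {(s + 2 - k - (j - 1), j - 1, k), (s + 2 - k - j, j, k)}"

definition start_edge :: "int \<Rightarrow> int \<Rightarrow> int \<Rightarrow> int \<Rightarrow> int \<Rightarrow> nat \<Rightarrow> edge" where
  "start_edge s c \<beta> \<gamma> C i =
     (if int i \<le> C then w_edge s c (int i) else w_edge s \<gamma> (\<beta> + (int i - C)))"

definition end_edge :: "int \<Rightarrow> int \<Rightarrow> nat \<Rightarrow> edge" where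
  "end_edge s A j = w_edge s 0 (A + int j)"

text \<open>
  The reflexive closure allows paths of length zero. They occur when \<open>\<gamma> = 0\<close>, where the
  starting points on the puncture are also end points.
\<close>

definition path_permutation ::
  "nat \<Rightarrow> (nat \<Rightarrow> edge) \<Rightarrow> (nat \<Rightarrow> edge) \<Rightarrow> triangle set set \<Rightarrow> nat \<Rightarrow> nat" where
  "path_permutation n starts ends T =
     (THE p. p permutes {1..n} \<and> (\<forall>i \<in> {1..n}. (starts i, ends (p i)) \<in> (path_steps T)\<^sup>*))"

definition int_binom :: "int \<Rightarrow> int \<Rightarrow> int" where
  "int_binom n k = (if k < 0 \<or> k > n then 0 else int (nat n choose nat k))"

text \<open>
  Library matrices are indexed from 0, hence the shift of \<open>i\<close> and \<open>j\<close>.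
\<close>

definition N_matrix ::
  "int \<Rightarrow> int \<Rightarrow> int \<Rightarrow> int \<Rightarrow> int \<Rightarrow> int \<Rightarrow> int mat" where
  "N_matrix c \<beta> \<gamma> A C M =
     mat (nat (C + M)) (nat (C + M)) (\<lambda>(i0, j0).
       let i = int i0 + 1; j = int j0 + 1
       in if i \<le> C then int_binom c (A + j - i) else int_binom \<gamma> (A + C - \<beta> + j - i))"

end

theory Submission
  imports Defs
begin

text \<open>
  A lozenge tiling is a system of particles that fall from the line \<open>w = c\<close> to the line \<open>w = 0\<close>,
  one line at a time, each of them moving to one of the two unit edges diagonally below the one it
  sits on: it keeps its \<open>v\<close> or increases it by one. The first \<open>C\<close> particles start on the hexagon side
  \<open>w = c\<close>, the remaining \<open>M\<close> on the puncture side \<open>w = \<gamma>\<close>, and no two of them ever share an edge.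
  The sign of the tiling is the sign of the final arrangement.

  The determinant is expanded along the same fall. Row \<open>i\<close> of the matrix is
  \<open>binom h (e j - x)\<close>, where \<open>x\<close> is the position of particle \<open>i\<close>, \<open>h\<close> the number of steps it still
  has to make and \<open>e j\<close> the \<open>j\<close>-th end point. By Pascal's rule such a row is the sum of the rows
  with \<open>h - 1\<close> for the positions \<open>x\<close> and \<open>x + 1\<close>, so multilinearity of the determinant lets all
  particles on the current line make one step (\<open>det_binom_mat_Suc\<close>). If two particles meet, two rows
  agree and the determinant vanishes (\<open>det_binom_mat_collision\<close>). On the last line the matrix has
  the entries \<open>[e j = x i]\<close>, and its determinant is the sign of the arrangement or, if an end point
  is missed, zero. Thus the determinant is the signed number of collision-free families
  that reach all end points (\<open>det_binom_mat_expansion\<close>).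

  Nothing in this expansion mentions the puncture or the sides of the hexagon. The sides are
  respected because the start and end points force it. A path that entered the puncture could not
  leave it through its slanted sides, as these diverge at exactly the speed of the steps; it would
  reach the base \<open>w = \<gamma>\<close> on an edge on which another particle starts, and collide
  (\<open>family_avoids_hole\<close>).

  Conversely, the tiling of a family consists of the lozenges crossed by the paths, together with
  one lozenge astride each unoccupied horizontal edge (\<open>tiling_of_in_tilings\<close>). Every tiling arises
  from exactly one family: following the lozenges downwards from the start edges recovers the paths,
  and a line-by-line induction shows that they meet all edges that are not astride a lozenge
  (\<open>track_bij\<close>).
\<close>

section \<open>Expanding a binomial determinant over families of paths\<close>

lemma permutes_less: "p permutes {0..<n} \<Longrightarrow> i < n \<Longrightarrow> p i < n" for n :: nat
  using permutes_in_image[of p "{0..<n}" i] by simp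

text \<open>
  Pascal's rule also holds outside the range \<open>0 \<le> m \<le> k + 1\<close>, so that the expansion below needs no
  case distinction for particles that can no longer reach a given end point.
\<close>

lemma int_binom_Suc:
  "int_binom (int (Suc k)) m = int_binom (int k) m + int_binom (int k) (m - 1)"
proof (cases "m \<le> 0")
  case True
  then show ?thesis
    by (cases "m = 0") (auto simp: int_binom_def)
next
  case False
  then obtain l where "m = int (Suc l)"
    by (metis not_le zero_less_imp_eq_int gr0_conv_Suc)
  then show ?thesis
    by (auto simp: int_binom_def nat_add_distrib binomial_eq_0)
qed

text \<open>
  At level \<open>k\<close>, particle \<open>i\<close> still has \<open>min k (h i)\<close> steps to go: it enters at level \<open>h i\<close>, and waits at
  its starting position while \<open>k > h i\<close>. With this convention waiting particles need no special
  treatment, and the matrices of all levels have the same size.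
\<close>

definition binom_mat :: "nat \<Rightarrow> (nat \<Rightarrow> nat) \<Rightarrow> (nat \<Rightarrow> int) \<Rightarrow> nat \<Rightarrow> (nat \<Rightarrow> int) \<Rightarrow> int mat" where
  "binom_mat n h e k x = mat n n (\<lambda>(i, j). int_binom (int (min k (h i))) (e j - x i))"

text \<open>
  The possible positions at level \<open>k - 1\<close> when \<open>x\<close> gives those at level \<open>k\<close>. Positions are extensional
  functions, so that the choices of all particles form a product set, over which a product of sums can
  be expanded.
\<close>

definition moves :: "nat \<Rightarrow> (nat \<Rightarrow> nat) \<Rightarrow> nat \<Rightarrow> (nat \<Rightarrow> int) \<Rightarrow> (nat \<Rightarrow> int) set" where
  "moves n h k x = PiE {0..<n} (\<lambda>i. if k \<le> h i then {x i, x i + 1} else {x i})"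

lemma finite_moves: "finite (moves n h k x)"
  unfolding moves_def by (rule finite_PiE) auto

text \<open>
  In the Leibniz formula every entry of an active row splits by Pascal's rule into two summands, one
  for each move; distributing the product over these sums and exchanging the two summations collects
  one smaller determinant for each joint move.
\<close>

lemma det_binom_mat_Suc:
  "det (binom_mat n h e (Suc k) x) = (\<Sum>y \<in> moves n h (Suc k) x. det (binom_mat n h e k y))"
proof -
  let ?g = "\<lambda>p i d. int_binom (int (min k (h i))) (e (p i) - d)"
  let ?D = "\<lambda>i. if Suc k \<le> h i then {x i, x i + 1} else {x i}"
  have row: "int_binom (int (min (Suc k) (h i))) (e (p i) - x i) = (\<Sum>d \<in> ?D i. ?g p i d)"
    for p :: "nat \<Rightarrow> nat" and i
    using int_binom_Suc[of k "e (p i) - x i"]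
    by (cases "Suc k \<le> h i") (auto simp: min_absorb1 min_absorb2 not_le algebra_simps)
  have "det (binom_mat n h e (Suc k) x) =
      (\<Sum>p | p permutes {0..<n}. sign p * (\<Prod>i = 0..<n. \<Sum>d \<in> ?D i. ?g p i d))"
    unfolding binom_mat_def
    by (subst det_def'[of _ n])
       (auto intro!: sum.cong arg_cong[where f = "(*) _"] prod.cong simp: permutes_less row[symmetric])
  also have "\<dots> = (\<Sum>p | p permutes {0..<n}. \<Sum>y \<in> moves n h (Suc k) x.
                     sign p * (\<Prod>i = 0..<n. ?g p i (y i)))"
    unfolding moves_def by (subst prod_sum_PiE) (auto simp: sum_distrib_left)
  also have "\<dots> = (\<Sum>y \<in> moves n h (Suc k) x. \<Sum>p | p permutes {0..<n}.
                     sign p * (\<Prod>i = 0..<n. ?g p i (y i)))"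
    by (rule sum.swap)
  also have "\<dots> = (\<Sum>y \<in> moves n h (Suc k) x. det (binom_mat n h e k y))"
    unfolding binom_mat_def
    by (subst det_def'[of _ n])
       (auto intro!: sum.cong arg_cong[where f = "(*) _"] prod.cong simp: permutes_less)
  finally show ?thesis .
qed

definition active :: "nat \<Rightarrow> (nat \<Rightarrow> nat) \<Rightarrow> nat \<Rightarrow> nat set" where
  "active n h k = {i \<in> {0..<n}. k \<le> h i}"

text \<open>
  Only particles that have already entered are compared: two active particles in the same position
  have the same number of remaining steps, hence equal rows. A waiting particle may well share its
  position number with a moving one.
\<close>

lemma det_binom_mat_collision:
  assumes "\<not> inj_on x (active n h k)"
  shows "det (binom_mat n h e k x) = 0"
proof -
  obtain i j where "i \<in> active n h k" "j \<in> active n h k" "i \<noteq> j" "x i = x j"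
    using assms by (auto simp: inj_on_def)
  then show ?thesis
    by (intro det_identical_rows[of _ n i j])
       (auto simp: binom_mat_def active_def min_absorb1 intro!: eq_vecI)
qed

text \<open>
  The value \<open>X l i\<close> is the position of particle \<open>i\<close> at level \<open>l\<close>. Levels above \<open>k\<close> repeat \<open>x\<close>; this makes
  a family a single total function that is determined by its positions at the levels up to \<open>k\<close>.
\<close>

definition path_families :: "nat \<Rightarrow> (nat \<Rightarrow> nat) \<Rightarrow> nat \<Rightarrow> (nat \<Rightarrow> int) \<Rightarrow> (nat \<Rightarrow> nat \<Rightarrow> int) set" where
  "path_families n h k x =
     {X. (\<forall>l \<ge> k. X l = x) \<and>
         (\<forall>l < k. X l \<in> moves n h (Suc l) (X (Suc l)) \<and> inj_on (X l) (active n h l))}"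

lemma path_families_0: "path_families n h 0 x = {\<lambda>_. x}"
  by (auto simp: path_families_def)

text \<open>
  Induction on the number of levels. A family from level \<open>k + 1\<close> is a collision-free first joint move
  followed by a family from level \<open>k\<close>, and the joint moves that collide contribute zero.
\<close>

lemma det_binom_mat_expansion:
  "finite (path_families n h k x) \<and>
   det (binom_mat n h e k x) = (\<Sum>X \<in> path_families n h k x. det (binom_mat n h e 0 (X 0)))"
proof (induction k arbitrary: x)
  case 0
  then show ?case by (simp add: path_families_0)
next
  case (Suc k)
  define Y where "Y = {y \<in> moves n h (Suc k) x. inj_on y (active n h k)}"
  define S where "S = Sigma Y (path_families n h k)"
  have fin: "finite Y" "finite S"
    unfolding Y_def S_def using Suc finite_moves by (auto intro!: finite_SigmaI)
  \<comment> \<open>\<open>ext\<close> prepends the first position, \<open>res\<close> splits it off.\<close>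
  define ext where "ext = (\<lambda>(y :: nat \<Rightarrow> int, X) l. if l \<le> k then X l else x)"
  define res where "res = (\<lambda>X :: nat \<Rightarrow> nat \<Rightarrow> int. (X k, \<lambda>l. if l \<le> k then X l else X k))"
  have ext: "ext z \<in> path_families n h (Suc k) x" "res (ext z) = z" if z: "z \<in> S" for z
  proof -
    obtain y X where [simp]: "z = (y, X)" by force
    have y: "y \<in> Y" and X: "X \<in> path_families n h k y" using z by (auto simp: S_def)
    have Xy: "X l = y" if "l \<ge> k" for l using X that by (auto simp: path_families_def)
    show "res (ext z) = z"
      using Xy by (auto simp: res_def ext_def)
    show "ext z \<in> path_families n h (Suc k) x"
      using X y by (auto simp: path_families_def ext_def Y_def less_Suc_eq)
  qed
  have res: "res X \<in> S" "ext (res X) = X" if "X \<in> path_families n h (Suc k) x" for X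
    using that by (auto simp: S_def Y_def res_def ext_def path_families_def not_le Suc_le_eq)
  have bij: "bij_betw ext S (path_families n h (Suc k) x)"
    by (rule bij_betwI[of _ _ _ res]) (use ext res in auto)
  have "det (binom_mat n h e (Suc k) x) = (\<Sum>y \<in> Y. det (binom_mat n h e k y))"
    unfolding det_binom_mat_Suc Y_def
    by (rule sum.mono_neutral_right) (auto simp: finite_moves det_binom_mat_collision)
  also have "\<dots> = (\<Sum>y \<in> Y. \<Sum>X \<in> path_families n h k y. det (binom_mat n h e 0 (X 0)))"
    using Suc by simp
  also have "\<dots> = (\<Sum>z \<in> S. det (binom_mat n h e 0 (ext z 0)))"
    unfolding S_def using fin Suc
    by (subst sum.Sigma) (auto simp: ext_def intro!: sum.cong)
  also have "\<dots> = (\<Sum>X \<in> path_families n h (Suc k) x. det (binom_mat n h e 0 (X 0)))"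
    using sum.reindex_bij_betw[OF bij] by simp
  finally show ?case
    using bij_betw_finite[OF bij] fin by simp
qed

text \<open>
  No steps remain, and \<open>int_binom 0 m\<close> is \<open>1\<close> for \<open>m = 0\<close> and \<open>0\<close> otherwise: the matrix is a permutation
  matrix.
\<close>

lemma det_binom_mat_0_permutation:
  assumes "p permutes {0..<n}" "inj_on e {0..<n}" "\<And>i. i < n \<Longrightarrow> x i = e (p i)"
  shows "det (binom_mat n h e 0 x) = sign p"
proof -
  have "binom_mat n h e 0 x = mat n n (\<lambda>(i, j). 1\<^sub>m n $$ (p i, j))"
    using assms
    by (intro eq_matI)
       (auto simp: binom_mat_def int_binom_def permutes_less inj_on_eq_iff[of e "{0..<n}"])
  then show ?thesis
    using det_permute_rows[of "1\<^sub>m n :: int mat" n p] assms(1) by simp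
qed

lemma det_binom_mat_0_missed:
  assumes "i < n" "x i \<notin> e ` {0..<n}"
  shows "det (binom_mat n h e 0 x) = 0"
proof -
  have "int_binom 0 (e (p i) - x i) = 0" if "p permutes {0..<n}" for p
  proof -
    have "e (p i) \<noteq> x i" using permutes_less[OF that assms(1)] assms(2) by force
    then show ?thesis by (auto simp: int_binom_def)
  qed
  then show ?thesis
    unfolding binom_mat_def using assms(1)
    by (subst det_def'[of _ n]) (auto intro!: sum.neutral prod_zero bexI[of _ i] simp: permutes_less)
qed

section \<open>Triangles, lozenges and their horizontal edges\<close>

text \<open>
  All points satisfy \<open>u + v + w = s + 2\<close>, so the coordinates \<open>v\<close> and \<open>w\<close> are enough.
\<close>

definition lpt :: "int \<Rightarrow> int \<Rightarrow> int \<Rightarrow> point" where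
  "lpt s v w = (s + 2 - v - w, v, w)"

lemma lpt_eq_iff [simp]: "lpt s v w = lpt s v' w' \<longleftrightarrow> v = v' \<and> w = w'"
  by (auto simp: lpt_def)

text \<open>
  The horizontal edge \<open>w_edge s k j\<close> lies on two unit triangles, one above and one below the line
  \<open>w = k\<close>, and every unit triangle has exactly one horizontal edge. Triangles of both orientations are
  therefore indexed by their horizontal edge.
\<close>

definition tri_above :: "int \<Rightarrow> int \<Rightarrow> int \<Rightarrow> triangle" where
  "tri_above s k j = {lpt s (j - 1) k, lpt s j k, lpt s (j - 1) (k + 1)}"

definition tri_below :: "int \<Rightarrow> int \<Rightarrow> int \<Rightarrow> triangle" where
  "tri_below s k j = {lpt s (j - 1) k, lpt s j k, lpt s j (k - 1)}"

lemma w_edge_lpt: "w_edge s k j = {lpt s (j - 1) k, lpt s j k}"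
  by (auto simp: w_edge_def lpt_def)

lemma w_edge_eq_iff [simp]: "w_edge s k j = w_edge s k' j' \<longleftrightarrow> k = k' \<and> j = j'"
  by (auto simp: w_edge_lpt doubleton_eq_iff)

lemma unit_triangles_eq:
  "unit_triangles s = {tri_above s k j | k j. True} \<union> {tri_below s k j | k j. True}"
proof -
  have above: "tri_above s k j = {(i + 1, j - 1, k), (i, j - 1 + 1, k), (i, j - 1, k + 1)}"
    if "i = s + 2 - j - k" for i j k
    using that by (auto simp: tri_above_def lpt_def)
  have below: "tri_below s (k + 1) j = {(i, j - 1 + 1, k + 1), (i + 1, j - 1, k + 1), (i + 1, j - 1 + 1, k)}"
    if "i = s + 1 - j - k" for i j k
    using that by (auto simp: tri_below_def lpt_def)
  show ?thesis
  proof (intro equalityI subsetI)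
    fix t assume "t \<in> unit_triangles s"
    then consider (a) i j k where "t = {(i + 1, j, k), (i, j + 1, k), (i, j, k + 1)}" "i + j + k = s + 1"
      | (b) i j k where "t = {(i, j + 1, k + 1), (i + 1, j, k + 1), (i + 1, j + 1, k)}" "i + j + k = s"
      unfolding unit_triangles_def by blast
    then show "t \<in> {tri_above s k j | k j. True} \<union> {tri_below s k j | k j. True}"
    proof cases
      case a
      then have "t = tri_above s k (j + 1)" using above[of i "j + 1" k] by simp
      then show ?thesis by blast
    next
      case b
      then have "t = tri_below s (k + 1) (j + 1)" using below[of i "j + 1" k] by simp
      then show ?thesis by blast
    qed
  next
    fix t assume "t \<in> {tri_above s k j | k j. True} \<union> {tri_below s k j | k j. True}"
    then consider (a) k j where "t = tri_above s k j" | (b) k j where "t = tri_below s k j" by blast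
    then show "t \<in> unit_triangles s"
    proof cases
      case a
      have "(s + 2 - j - k) + (j - 1) + k = s + 1" by simp
      then show ?thesis unfolding a unit_triangles_def above[OF refl] by blast
    next
      case b
      have "(s + 1 - j - (k - 1)) + (j - 1) + (k - 1) = s" by simp
      moreover have "t = {(s + 1 - j - (k - 1), j - 1 + 1, k - 1 + 1),
          (s + 1 - j - (k - 1) + 1, j - 1, k - 1 + 1), (s + 1 - j - (k - 1) + 1, j - 1 + 1, k - 1)}"
        using below[of "s + 1 - j - (k - 1)" j "k - 1"] b by simp
      ultimately show ?thesis unfolding unit_triangles_def by blast
    qed
  qed
qed

lemma tri_edges_insert3:
  assumes "x \<noteq> y" "x \<noteq> z" "y \<noteq> z"
  shows "tri_edges {x, y, z} = {{x, y}, {x, z}, {y, z}}"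
proof (intro equalityI subsetI)
  fix e assume "e \<in> tri_edges {x, y, z}"
  then obtain p q where "e = {p, q}" "p \<noteq> q" "p \<in> {x, y, z}" "q \<in> {x, y, z}"
    unfolding tri_edges_def card_2_iff by blast
  then show "e \<in> {{x, y}, {x, z}, {y, z}}" by (auto simp: insert_commute)
next
  fix e assume "e \<in> {{x, y}, {x, z}, {y, z}}"
  then show "e \<in> tri_edges {x, y, z}" using assms unfolding tri_edges_def by auto
qed

lemma tri_edges_above:
  "tri_edges (tri_above s k j) =
     {w_edge s k j, {lpt s (j - 1) k, lpt s (j - 1) (k + 1)}, {lpt s j k, lpt s (j - 1) (k + 1)}}"
  unfolding tri_above_def w_edge_lpt by (rule tri_edges_insert3) auto

lemma tri_edges_below:
  "tri_edges (tri_below s k j) =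
     {w_edge s k j, {lpt s (j - 1) k, lpt s j (k - 1)}, {lpt s j k, lpt s j (k - 1)}}"
  unfolding tri_below_def w_edge_lpt by (rule tri_edges_insert3) auto

lemma tri_above_eq_iff [simp]: "tri_above s k j = tri_above s k' j' \<longleftrightarrow> k = k' \<and> j = j'"
proof
  assume "tri_above s k j = tri_above s k' j'"
  then have "w_edge s k j \<in> tri_edges (tri_above s k' j')" 
    by (metis tri_edges_above insertI1)
  then show "k = k' \<and> j = j'"
    by (auto simp: tri_edges_above w_edge_lpt doubleton_eq_iff)
qed simp

lemma tri_below_eq_iff [simp]: "tri_below s k j = tri_below s k' j' \<longleftrightarrow> k = k' \<and> j = j'"
proof
  assume "tri_below s k j = tri_below s k' j'"
  then have "w_edge s k j \<in> tri_edges (tri_below s k' j')"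
    by (metis tri_edges_below insertI1)
  then show "k = k' \<and> j = j'"
    by (auto simp: tri_edges_below w_edge_lpt doubleton_eq_iff)
qed simp

lemma tri_above_neq_below [simp]: "tri_above s k j \<noteq> tri_below s k' j'" "tri_below s k' j' \<noteq> tri_above s k j"
proof -
  show "tri_above s k j \<noteq> tri_below s k' j'"
  proof
    assume eq: "tri_above s k j = tri_below s k' j'"
    then have "w_edge s k j \<in> tri_edges (tri_below s k' j')"
      by (metis tri_edges_above insertI1)
    then have "k = k'" "j = j'"
      by (auto simp: tri_edges_below w_edge_lpt doubleton_eq_iff)
    moreover have "lpt s (j - 1) (k + 1) \<in> tri_below s k' j'"
      unfolding eq[symmetric] tri_above_def by simp
    ultimately show False by (auto simp: tri_below_def)
  qed
  then show "tri_below s k' j' \<noteq> tri_above s k j" by metis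
qed

text \<open>
  The triangle below the edge \<open>(k, j)\<close> has three neighbours: the one across that edge, and the two that
  stand on the edges \<open>j\<close> and \<open>j + 1\<close> of the line \<open>w = k - 1\<close>.
\<close>

definition partner :: "int \<Rightarrow> int \<Rightarrow> int \<Rightarrow> int \<Rightarrow> bool" where
  "partner k j k' j' \<longleftrightarrow> k' = k \<and> j' = j \<or> k' = k - 1 \<and> (j' = j \<or> j' = j + 1)"

lemma share_edge_above_below:
  "tri_edges (tri_below s k j) \<inter> tri_edges (tri_above s k' j') \<noteq> {} \<longleftrightarrow> partner k j k' j'"
  by (auto simp: tri_edges_above tri_edges_below w_edge_lpt doubleton_eq_iff partner_def)

lemma share_edge_above_above:
  "tri_edges (tri_above s k j) \<inter> tri_edges (tri_above s k' j') \<noteq> {} \<longleftrightarrow> k = k' \<and> j = j'"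
  by (auto simp: tri_edges_above w_edge_lpt doubleton_eq_iff)

lemma share_edge_below_below:
  "tri_edges (tri_below s k j) \<inter> tri_edges (tri_below s k' j') \<noteq> {} \<longleftrightarrow> k = k' \<and> j = j'"
  by (auto simp: tri_edges_below w_edge_lpt doubleton_eq_iff)

definition loz :: "int \<Rightarrow> int \<Rightarrow> int \<Rightarrow> int \<Rightarrow> int \<Rightarrow> triangle set" where
  "loz s k j k' j' = {tri_below s k j, tri_above s k' j'}"

lemma loz_eq_iff [simp]:
  "loz s k j k' j' = loz s l i l' i' \<longleftrightarrow> k = l \<and> j = i \<and> k' = l' \<and> j' = i'"
  by (auto simp: loz_def doubleton_eq_iff)

lemma mem_loz [simp]:
  "tri_below s k j \<in> loz s l i l' i' \<longleftrightarrow> k = l \<and> j = i"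
  "tri_above s k' j' \<in> loz s l i l' i' \<longleftrightarrow> k' = l' \<and> j' = i'"
  by (auto simp: loz_def)

lemma loz_subset_iff: "loz s k j k' j' \<subseteq> R \<longleftrightarrow> tri_below s k j \<in> R \<and> tri_above s k' j' \<in> R"
  by (simp add: loz_def)

lemma loz_nonempty [simp]: "loz s k j k' j' \<noteq> {}"
  by (simp add: loz_def)

text \<open>
  Triangles of the same orientation never share an edge, so each lozenge consists of one triangle of
  each kind.
\<close>

lemma lozenges_eq: "lozenges s = {loz s k j k' j' | k j k' j'. partner k j k' j'}"
proof (intro equalityI subsetI)
  fix L assume "L \<in> lozenges s"
  then obtain t t' where L: "L = {t, t'}" "t \<in> unit_triangles s" "t' \<in> unit_triangles s" "t \<noteq> t'"
    and e: "tri_edges t \<inter> tri_edges t' \<noteq> {}" unfolding lozenges_def by blast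
  have e': "tri_edges t' \<inter> tri_edges t \<noteq> {}" using e by blast
  consider (aa) k j k' j' where "t = tri_above s k j" "t' = tri_above s k' j'"
    | (bb) k j k' j' where "t = tri_below s k j" "t' = tri_below s k' j'"
    | (ab) k j k' j' where "t = tri_above s k j" "t' = tri_below s k' j'"
    | (ba) k j k' j' where "t = tri_below s k j" "t' = tri_above s k' j'"
    using L(2,3) unfolding unit_triangles_eq by blast
  then show "L \<in> {loz s k j k' j' | k j k' j'. partner k j k' j'}"
  proof cases
    case aa
    then show ?thesis using L(4) e unfolding aa share_edge_above_above by simp
  next
    case bb
    then show ?thesis using L(4) e unfolding bb share_edge_below_below by simp
  next
    case ab
    then have "partner k' j' k j" "L = loz s k' j' k j"
      using e' L(1) unfolding ab share_edge_above_below loz_def by blast+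
    then show ?thesis by blast
  next
    case ba
    then have "partner k j k' j'" "L = loz s k j k' j'"
      using e L(1) unfolding ba share_edge_above_below loz_def by blast+
    then show ?thesis by blast
  qed
next
  fix L assume "L \<in> {loz s k j k' j' | k j k' j'. partner k j k' j'}"
  then obtain k j k' j' where L: "L = loz s k j k' j'" "partner k j k' j'" by blast
  have "tri_below s k j \<in> unit_triangles s" "tri_above s k' j' \<in> unit_triangles s"
    unfolding unit_triangles_eq by blast+
  moreover have "tri_edges (tri_below s k j) \<inter> tri_edges (tri_above s k' j') \<noteq> {}"
    unfolding share_edge_above_below by (rule L(2))
  moreover have "tri_below s k j \<noteq> tri_above s k' j'" by simp
  ultimately show "L \<in> lozenges s"
    unfolding lozenges_def L(1) loz_def by blast
qed

lemma marked_w_edge [simp]: "marked (w_edge s k j)"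
  by (auto simp: marked_def w_edge_def)

lemma marked_doubleton_lpt: "marked {lpt s v w, lpt s v' w'} \<longleftrightarrow> w = w'"
  by (auto simp: marked_def lpt_def)

lemma marked_edge_above: "e \<in> tri_edges (tri_above s k j) \<and> marked e \<longleftrightarrow> e = w_edge s k j"
  by (auto simp: tri_edges_above marked_doubleton_lpt)

lemma marked_edge_below: "e \<in> tri_edges (tri_below s k j) \<and> marked e \<longleftrightarrow> e = w_edge s k j"
  by (auto simp: tri_edges_below marked_doubleton_lpt)

lemma ex1_doubleton: "x \<noteq> y \<Longrightarrow> (\<exists>!t. t \<in> {x, y} \<and> Q t) \<longleftrightarrow> Q x \<noteq> Q y"
  by (cases "Q x"; cases "Q y") auto

text \<open>
  A lozenge astride a horizontal edge has that edge in its interior and no other, so no path uses it;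
  in the other two lozenges the horizontal edges of both triangles are opposite boundary edges.
\<close>

lemma marked_boundary_loz:
  assumes "partner k j k' j'"
  shows "e \<in> boundary_edges (loz s k j k' j') \<and> marked e \<longleftrightarrow>
           k' = k - 1 \<and> (e = w_edge s k j \<or> e = w_edge s k' j')"
proof -
  have "e \<in> boundary_edges (loz s k j k' j') \<longleftrightarrow>
      (e \<in> tri_edges (tri_below s k j)) \<noteq> (e \<in> tri_edges (tri_above s k' j'))"
    unfolding boundary_edges_def loz_def mem_Collect_eq by (rule ex1_doubleton) simp
  then have "e \<in> boundary_edges (loz s k j k' j') \<and> marked e \<longleftrightarrow>
      (e = w_edge s k j) \<noteq> (e = w_edge s k' j')"
    unfolding marked_edge_above[symmetric, of e s k' j'] marked_edge_below[symmetric, of e s k j]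
    by blast
  moreover have "w_edge s k j = w_edge s k' j' \<longleftrightarrow> k' \<noteq> k - 1"
    using assms unfolding partner_def by auto
  ultimately show ?thesis by metis
qed

lemma path_steps_iff:
  assumes "T \<subseteq> lozenges s"
  shows "(e, e') \<in> path_steps T \<longleftrightarrow>
    (\<exists>k j j'. loz s k j (k - 1) j' \<in> T \<and>
       (e = w_edge s k j \<and> e' = w_edge s (k - 1) j' \<or> e = w_edge s (k - 1) j' \<and> e' = w_edge s k j))"
    (is "_ \<longleftrightarrow> ?R")
proof
  assume "(e, e') \<in> path_steps T"
  then obtain L where L: "L \<in> T" "e \<in> boundary_edges L \<and> marked e" "e' \<in> boundary_edges L \<and> marked e'"
    "e \<inter> e' = {}" unfolding path_steps_def by blast
  obtain k j k' j' where k: "L = loz s k j k' j'" "partner k j k' j'"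
    using assms L(1) unfolding lozenges_eq by blast
  have "e \<noteq> e'" using L by (auto simp: marked_boundary_loz[OF k(2)] k(1) w_edge_def)
  with L show ?R
    unfolding k(1) marked_boundary_loz[OF k(2)] by auto
next
  assume ?R
  then obtain k j j' where k: "loz s k j (k - 1) j' \<in> T"
    "e = w_edge s k j \<and> e' = w_edge s (k - 1) j' \<or> e = w_edge s (k - 1) j' \<and> e' = w_edge s k j" by blast
  have p: "partner k j (k - 1) j'"
    using assms k(1) unfolding lozenges_eq by auto
  have "w_edge s k j \<inter> w_edge s (k - 1) j' = {}" by (auto simp: w_edge_lpt)
  then have "e \<inter> e' = {}" using k(2) by blast
  then show "(e, e') \<in> path_steps T"
    using marked_boundary_loz[OF p, of e s] marked_boundary_loz[OF p, of e' s] k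
    unfolding path_steps_def by blast
qed

section \<open>Lozenge tilings as matchings of triangles\<close>

text \<open>
  This reduces the equality of two tilings of the same region to one inclusion.
\<close>

lemma partition_on_subset_eq:
  assumes "partition_on R T" "partition_on R T'" "T \<subseteq> T'"
  shows "T = T'"
proof
  show "T' \<subseteq> T"
  proof
    fix L assume L: "L \<in> T'"
    then have "L \<noteq> {}" using assms(2) partition_onD3 by blast
    then obtain t where t: "t \<in> L" by blast
    then have "t \<in> \<Union>T" using L assms(1,2) unfolding partition_on_def by blast
    then obtain L' where L': "L' \<in> T" "t \<in> L'" by blast
    then have "L' = L"
      using L t assms(3) disjointD[OF partition_onD2[OF assms(2)], of L' L] by blast
    then show "L \<in> T" using L' by simp
  qed
qed fact

context
  fixes s R T
  assumes T: "T \<in> lozenge_tilings s R"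
begin

lemma tiling_lozD:
  assumes "loz s k j k' j' \<in> T"
  shows "partner k j k' j'" "tri_below s k j \<in> R" "tri_above s k' j' \<in> R"
proof -
  have "loz s k j k' j' \<in> lozenges s" "loz s k j k' j' \<subseteq> R"
    using assms T unfolding lozenge_tilings_def partition_on_def by blast+
  then show "partner k j k' j'" "tri_below s k j \<in> R" "tri_above s k' j' \<in> R"
    unfolding lozenges_eq by (auto simp: loz_subset_iff)
qed

lemma tiling_loz_cover:
  assumes "t \<in> R"
  obtains k j k' j' where "loz s k j k' j' \<in> T" "t \<in> loz s k j k' j'"
proof -
  obtain L where "L \<in> T" "t \<in> L"
    using assms T unfolding lozenge_tilings_def partition_on_def by blast
  moreover from this have "L \<in> lozenges s" using T unfolding lozenge_tilings_def by blast
  ultimately show ?thesis using that unfolding lozenges_eq by blast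
qed

lemma tiling_loz_unique:
  assumes "loz s k j k' j' \<in> T" "loz s l i l' i' \<in> T" "k = l \<and> j = i \<or> k' = l' \<and> j' = i'"
  shows "k = l \<and> j = i \<and> k' = l' \<and> j' = i'"
proof -
  have "loz s k j k' j' \<inter> loz s l i l' i' \<noteq> {}"
    using assms(3) unfolding loz_def by blast
  then have "loz s k j k' j' = loz s l i l' i'"
    using assms(1,2) T disjointD[of T "loz s k j k' j'" "loz s l i l' i'"]
    unfolding lozenge_tilings_def partition_on_def by blast
  then show ?thesis by simp
qed

lemma tiling_below_cover:
  assumes "tri_below s k j \<in> R"
  obtains k' j' where "loz s k j k' j' \<in> T" "partner k j k' j'"
proof (rule tiling_loz_cover[OF assms])
  fix l i l' i' assume "loz s l i l' i' \<in> T" "tri_below s k j \<in> loz s l i l' i'"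
  then show thesis using that[of l' i'] tiling_lozD(1) by simp
qed

lemma tiling_above_cover:
  assumes "tri_above s k' j' \<in> R"
  obtains k j where "loz s k j k' j' \<in> T" "partner k j k' j'"
proof (rule tiling_loz_cover[OF assms])
  fix l i l' i' assume "loz s l i l' i' \<in> T" "tri_above s k' j' \<in> loz s l i l' i'"
  then show thesis using that[of l i] tiling_lozD(1) by simp
qed

end

text \<open>
  A tiling is a perfect matching between the triangles below and above horizontal edges: each triangle
  of either kind has exactly one partner.
\<close>

lemma lozenge_tilingsI:
  assumes R: "R \<subseteq> unit_triangles s"
    and loz: "\<And>L. L \<in> T \<Longrightarrow> \<exists>k j k' j'. L = loz s k j k' j' \<and> partner k j k' j' \<and>
                 tri_below s k j \<in> R \<and> tri_above s k' j' \<in> R"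
    and below: "\<And>k j. tri_below s k j \<in> R \<Longrightarrow> \<exists>k' j'. loz s k j k' j' \<in> T"
    and above: "\<And>k' j'. tri_above s k' j' \<in> R \<Longrightarrow> \<exists>k j. loz s k j k' j' \<in> T"
    and below_unique: "\<And>k j k' j' l i. \<lbrakk>loz s k j k' j' \<in> T; loz s k j l i \<in> T\<rbrakk> \<Longrightarrow> k' = l \<and> j' = i"
    and above_unique: "\<And>k j k' j' l i. \<lbrakk>loz s k j k' j' \<in> T; loz s l i k' j' \<in> T\<rbrakk> \<Longrightarrow> k = l \<and> j = i"
  shows "T \<in> lozenge_tilings s R"
proof -
  have "T \<subseteq> lozenges s" using loz unfolding lozenges_eq by blast
  moreover have "partition_on R T"
  proof (rule partition_onI)
    show "\<Union>T = R"
    proof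
      show "\<Union>T \<subseteq> R" using loz loz_subset_iff by (metis Sup_least)
      show "R \<subseteq> \<Union>T"
      proof
        fix t assume t: "t \<in> R"
        then consider (a) k j where "t = tri_above s k j" | (b) k j where "t = tri_below s k j"
          using R unfolding unit_triangles_eq by blast
        then show "t \<in> \<Union>T"
        proof cases
          case a
          then show ?thesis using above t mem_loz(2) by blast
        next
          case b
          then show ?thesis using below t mem_loz(1) by blast
        qed
      qed
    qed
    show "{} \<notin> T" using loz loz_nonempty by metis
    fix L L' assume L: "L \<in> T" "L' \<in> T" "L \<noteq> L'"
    obtain k j k' j' where 1: "L = loz s k j k' j'" using loz[OF L(1)] by blast
    obtain l i l' i' where 2: "L' = loz s l i l' i'" using loz[OF L(2)] by blast
    show "disjnt L L'"
    proof (rule ccontr)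
      assume "\<not> disjnt L L'"
      then obtain t where t: "t \<in> L" "t \<in> L'" unfolding disjnt_def by blast
      have "t = tri_below s k j \<or> t = tri_above s k' j'"
        using t(1) unfolding 1 loz_def by simp
      then have "k = l \<and> j = i \<or> k' = l' \<and> j' = i'"
        using t(2) unfolding 2 by (elim disjE) simp_all
      then have "L = L'"
        using L(1,2) below_unique above_unique unfolding 1 2 by (metis loz_eq_iff)
      with L(3) show False by simp
    qed
  qed
  ultimately show ?thesis unfolding lozenge_tilings_def by blast
qed

section \<open>Tilings of the punctured hexagon and path families\<close>

locale punctured_hexagon_params =
  fixes a b c \<alpha> \<beta> \<gamma> s A B C M :: int
  assumes nonneg: "0 \<le> \<alpha>" "0 \<le> \<beta>" "0 \<le> \<gamma>" "0 \<le> A" "0 \<le> B" "0 \<le> C" "0 \<le> M"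
    and gamma_less: "\<gamma> < c"
    and sum_eq: "a + b + c + \<alpha> + \<beta> + \<gamma> = 3 * (s + 2)"
    and ABCM: "A = s + 2 - a" "B = s + 2 - b" "C = s + 2 - c" "M = s + 2 - (\<alpha> + \<beta> + \<gamma>)"
    and le: "A \<le> \<beta> + \<gamma>" "B \<le> \<alpha> + \<gamma>" "C \<le> \<alpha> + \<beta>"
begin

abbreviation "R \<equiv> punctured_hexagon s a b c \<alpha> \<beta> \<gamma>"
abbreviation "n \<equiv> nat (C + M)"

text \<open>
  Particles are numbered from \<open>0\<close>: particle \<open>i\<close> belongs to the path of \<open>A\<^sub>i\<^sub>+\<^sub>1\<close>, and positions are the last
  argument of \<open>w_edge\<close>, which is the \<open>v\<close>-coordinate of the right end of the edge.
\<close>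

definition birth :: "nat \<Rightarrow> nat" where
  "birth i = nat (if int i < C then c else \<gamma>)"

definition start :: "nat \<Rightarrow> int" where
  "start = (\<lambda>i \<in> {0..<n}. if int i < C then int i + 1 else \<beta> + (int i + 1 - C))"

definition target :: "nat \<Rightarrow> int" where
  "target i = A + int i + 1"

abbreviation "act \<equiv> active n birth"

lemma sides: "a = B + C + M" "b = A + C + M" "c = A + B + M" "s = A + B + C + M - 2"
  and puncture_sum: "\<alpha> + \<beta> + \<gamma> = A + B + C"
  using ABCM sum_eq by presburger+

lemma mem_act: "i \<in> act k \<longleftrightarrow> i < n \<and> k \<le> birth i"
  by (auto simp: active_def)

lemma birth_cases:
  "int i < C \<and> birth i = nat c \<or> \<not> int i < C \<and> birth i = nat \<gamma>"
  by (auto simp: birth_def)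

lemma start_left: "i < n \<Longrightarrow> int i < C \<Longrightarrow> start i = int i + 1"
  and start_right: "i < n \<Longrightarrow> \<not> int i < C \<Longrightarrow> start i = \<beta> + (int i + 1 - C)"
  by (simp_all add: start_def)

text \<open>
  The positions on the line \<open>w = k\<close> inside the hexagon, and those inside the two slanted sides of the
  puncture (extended below its base). For an edge strictly between the lines \<open>w = 0\<close> and \<open>w = c\<close>, away
  from the base of the puncture, the triangle above lies in the region iff the one below does; the
  exceptions are the start and end edges of the paths.
\<close>

definition cell :: "int \<Rightarrow> int \<Rightarrow> bool" where
  "cell k j \<longleftrightarrow> 1 \<le> j \<and> j \<le> b \<and> A - k < j \<and> j \<le> s + 2 - k"

definition hole :: "int \<Rightarrow> int \<Rightarrow> bool" where
  "hole k j \<longleftrightarrow> \<beta> < j \<and> j \<le> s + 2 - \<alpha> - k"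

lemma above_in_R:
  "tri_above s k j \<in> R \<longleftrightarrow> 0 \<le> k \<and> k < c \<and> cell k j \<and> \<not> (\<gamma> \<le> k \<and> hole k j)"
proof -
  have "tri_above s k j \<in> unit_triangles s" unfolding unit_triangles_eq by blast
  moreover have "(\<forall>(u, v, w) \<in> tri_above s k j. 0 \<le> u \<and> 0 \<le> v \<and> 0 \<le> w \<and> u \<le> a \<and> v \<le> b \<and> w \<le> c)
      \<longleftrightarrow> 0 \<le> k \<and> k < c \<and> cell k j"
    using ABCM(1) unfolding cell_def tri_above_def lpt_def by auto
  moreover have "(\<forall>(u, v, w) \<in> tri_above s k j. \<alpha> \<le> u \<and> \<beta> \<le> v \<and> \<gamma> \<le> w) \<longleftrightarrow> \<gamma> \<le> k \<and> hole k j"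
    unfolding hole_def tri_above_def lpt_def by auto
  ultimately show ?thesis unfolding punctured_hexagon_def by blast
qed

lemma below_in_R:
  "tri_below s k j \<in> R \<longleftrightarrow> 0 < k \<and> k \<le> c \<and> cell k j \<and> \<not> (\<gamma> < k \<and> hole k j)"
proof -
  have "tri_below s k j \<in> unit_triangles s" unfolding unit_triangles_eq by blast
  moreover have "(\<forall>(u, v, w) \<in> tri_below s k j. 0 \<le> u \<and> 0 \<le> v \<and> 0 \<le> w \<and> u \<le> a \<and> v \<le> b \<and> w \<le> c)
      \<longleftrightarrow> 0 < k \<and> k \<le> c \<and> cell k j"
    using ABCM(1) unfolding cell_def tri_below_def lpt_def by auto
  moreover have "(\<forall>(u, v, w) \<in> tri_below s k j. \<alpha> \<le> u \<and> \<beta> \<le> v \<and> \<gamma> \<le> w) \<longleftrightarrow> \<gamma> < k \<and> hole k j"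
    unfolding hole_def tri_below_def lpt_def by auto
  ultimately show ?thesis unfolding punctured_hexagon_def by blast
qed

lemma cell_top: "cell c j \<longleftrightarrow> (\<exists>i. i < n \<and> int i < C \<and> j = start i)"
proof
  assume "cell c j"
  then have "1 \<le> j" "j \<le> C" using sides puncture_sum unfolding cell_def by auto
  then have "nat (j - 1) < n \<and> int (nat (j - 1)) < C \<and> j = start (nat (j - 1))"
    using nonneg start_left[of "nat (j - 1)"] by auto
  then show "\<exists>i. i < n \<and> int i < C \<and> j = start i" by blast
next
  assume "\<exists>i. i < n \<and> int i < C \<and> j = start i"
  then show "cell c j"
    using sides puncture_sum nonneg start_left unfolding cell_def by auto
qed

lemma hole_base: "hole \<gamma> j \<longleftrightarrow> (\<exists>i. i < n \<and> \<not> int i < C \<and> j = start i)"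
proof
  assume "hole \<gamma> j"
  then have "\<beta> < j" "j \<le> \<beta> + M" using sides puncture_sum unfolding hole_def by auto
  then have "nat (C + (j - \<beta>) - 1) < n \<and> \<not> int (nat (C + (j - \<beta>) - 1)) < C \<and>
      j = start (nat (C + (j - \<beta>) - 1))"
    using nonneg start_right[of "nat (C + (j - \<beta>) - 1)"] by auto
  then show "\<exists>i. i < n \<and> \<not> int i < C \<and> j = start i" by blast
next
  assume "\<exists>i. i < n \<and> \<not> int i < C \<and> j = start i"
  then show "hole \<gamma> j"
    using sides puncture_sum nonneg start_right unfolding hole_def by auto
qed

text \<open>
  The bounds on \<open>A\<close>, \<open>B\<close> and \<open>C\<close> say that the puncture lies inside the hexagon: \<open>A \<le> \<beta> + \<gamma>\<close> and
  \<open>B \<le> \<alpha> + \<gamma>\<close> keep the two ends of its base inside, and \<open>C \<le> \<alpha> + \<beta>\<close> keeps its tip on or below the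
  line \<open>w = c\<close>.
\<close>

lemma cell_hole_base: "hole \<gamma> j \<Longrightarrow> cell \<gamma> j"
  using sides puncture_sum nonneg le unfolding hole_def cell_def by auto

lemma no_hole_top: "cell c j \<Longrightarrow> \<not> hole c j"
  using sides puncture_sum nonneg le unfolding hole_def cell_def by auto

lemma cell_bottom: "cell 0 j \<longleftrightarrow> j \<in> target ` {0..<n}"
proof -
  have "cell 0 j \<longleftrightarrow> A < j \<and> j \<le> A + C + M"
    using nonneg sides unfolding cell_def by auto
  also have "\<dots> \<longleftrightarrow> j \<in> target ` {0..<n}"
  proof
    assume "A < j \<and> j \<le> A + C + M"
    then have "j = target (nat (j - A - 1))" "nat (j - A - 1) \<in> {0..<n}"
      by (auto simp: target_def)
    then show "j \<in> target ` {0..<n}" by blast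
  qed (use nonneg in \<open>auto simp: target_def\<close>)
  finally show ?thesis .
qed

lemma inj_target: "inj_on target {0..<n}"
  by (auto simp: inj_on_def target_def)

text \<open>
  Equal levels of entry are essential here: a particle from the hexagon side and one from the puncture
  side may start in the same position on different lines.
\<close>

lemma inj_start_same_birth:
  "\<lbrakk>i < n; i' < n; birth i = birth i'; start i = start i'\<rbrakk> \<Longrightarrow> i = i'"
  using birth_cases[of i] birth_cases[of i'] gamma_less nonneg start_left start_right by auto

definition families :: "(nat \<Rightarrow> nat \<Rightarrow> int) set" where
  "families = {X \<in> path_families n birth (nat c) start. X 0 ` {0..<n} = target ` {0..<n}}"

text \<open>
  The step of particle \<open>i\<close> from level \<open>k + 1\<close> to level \<open>k\<close> crosses one lozenge; the triangles below
  unoccupied edges are matched with the triangles above the same edges.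
\<close>

definition tiling_of :: "(nat \<Rightarrow> nat \<Rightarrow> int) \<Rightarrow> triangle set set" where
  "tiling_of X =
     {loz s (int k + 1) (X (Suc k) i) (int k) (X k i) | i k. i < n \<and> k < birth i} \<union>
     {loz s k j k j | k j. tri_below s k j \<in> R \<and> j \<notin> X (nat k) ` act (nat k)}"

lemma loz_in_tiling_of:
  "loz s k j k' j' \<in> tiling_of X \<longleftrightarrow>
     (\<exists>i l. i < n \<and> l < birth i \<and> k = int l + 1 \<and> j = X (Suc l) i \<and> k' = int l \<and> j' = X l i) \<or>
     (k' = k \<and> j' = j \<and> tri_below s k j \<in> R \<and> j \<notin> X (nat k) ` act (nat k))"
  unfolding tiling_of_def by auto

lemma birth_le: "birth i \<le> nat c"
  using gamma_less by (auto simp: birth_def)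

context
  fixes X
  assumes X: "X \<in> families"
begin

lemma family_top: "nat c \<le> k \<Longrightarrow> X k = start"
  using X by (auto simp: families_def path_families_def)

lemma family_step:
  assumes "i < n" "k < birth i"
  shows "X k i = X (Suc k) i \<or> X k i = X (Suc k) i + 1"
proof -
  have "X k \<in> moves n birth (Suc k) (X (Suc k))"
    using X assms birth_le[of i] by (auto simp: families_def path_families_def)
  then show ?thesis
    using assms by (auto simp: moves_def dest!: PiE_mem[of _ _ _ i])
qed

lemma family_start:
  assumes "i < n" "birth i \<le> k"
  shows "X k i = start i"
proof (cases "k \<le> nat c")
  case True
  then show ?thesis using assms(2)
  proof (induction k rule: inc_induct)
    case base
    then show ?case by (simp add: family_top)
  next
    case (step l)
    have "X l \<in> moves n birth (Suc l) (X (Suc l))"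
      using X step by (auto simp: families_def path_families_def)
    then have "X l i = X (Suc l) i"
      using assms(1) step by (auto simp: moves_def dest!: PiE_mem[of _ _ _ i])
    with step show ?case by simp
  qed
qed (simp add: family_top)

text \<open>
  On the levels below \<open>c\<close> this is part of the definition of a family; on level \<open>c\<close> only the first \<open>C\<close>
  particles are present, and they start at different positions.
\<close>

lemma family_inj: "i \<in> act k \<Longrightarrow> i' \<in> act k \<Longrightarrow> X k i = X k i' \<Longrightarrow> i = i'"
proof -
  assume i: "i \<in> act k" "i' \<in> act k" "X k i = X k i'"
  show "i = i'"
  proof (cases "k < nat c")
    case True
    then have "inj_on (X k) (act k)" using X by (auto simp: families_def path_families_def)
    then show ?thesis using i by (auto dest: inj_onD)
  next
    case False
    then have "birth i = k" "birth i' = k"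
      using i birth_le[of i] birth_le[of i'] by (auto simp: mem_act)
    then show ?thesis
      using i False inj_start_same_birth[of i i'] by (auto simp: mem_act family_top)
  qed
qed

lemma family_between:
  assumes "i < n" "l \<le> k" "k \<le> birth i"
  shows "X k i \<le> X l i" "X l i \<le> X k i + (int k - int l)"
proof -
  have "X k i \<le> X l i \<and> X l i \<le> X k i + (int k - int l)"
    using assms(2,3)
  proof (induction l rule: inc_induct)
    case (step m)
    then show ?case using family_step[of i m] assms(1) by auto
  qed simp
  then show "X k i \<le> X l i" "X l i \<le> X k i + (int k - int l)" by auto
qed

lemma family_bottom: "i < n \<Longrightarrow> A < X 0 i \<and> X 0 i \<le> b"
proof -
  assume "i < n"
  then have "X 0 i \<in> target ` {0..<n}"
    using X by (auto simp: families_def)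
  then show ?thesis using cell_bottom[of "X 0 i"] by (auto simp: cell_def)
qed

text \<open>
  Each side of the hexagon is respected because of one end of the path: neither \<open>v\<close> nor \<open>u\<close> decreases
  along a step, so the start point bounds both from below and the end point bounds both from above.
\<close>

lemma family_cell:
  assumes "i \<in> act k"
  shows "cell (int k) (X k i)"
proof -
  have i: "i < n" "k \<le> birth i" using assms by (auto simp: mem_act)
  have "start i \<le> X k i" "X k i \<le> start i + (int (birth i) - int k)"
    using family_between[of i k "birth i"] family_start[of i "birth i"] i by auto
  moreover have "1 \<le> start i" "start i + int (birth i) \<le> s + 2"
    using birth_cases[of i] start_left[of i] start_right[of i] i nonneg gamma_less sides puncture_sum by auto
  moreover have "X k i \<le> X 0 i" "X 0 i \<le> X k i + int k"
    using family_between[of i 0 k] i by auto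
  ultimately show ?thesis
    using family_bottom[of i] i unfolding cell_def by auto
qed

text \<open>
  Inside the puncture the left border \<open>v = \<beta>\<close> does not move and the right border \<open>u = \<alpha>\<close> moves one step
  to the right per level. A particle that is inside stays inside until level \<open>\<gamma>\<close>, where all positions
  are start positions of the particles from the puncture.
\<close>

lemma family_avoids_hole:
  assumes "i \<in> act k" "int i < C" "\<gamma> \<le> int k"
  shows "\<not> hole (int k) (X k i)"
proof
  assume hole: "hole (int k) (X k i)"
  have i: "i < n" "k \<le> birth i" "nat \<gamma> \<le> k" using assms by (auto simp: mem_act)
  have "hole \<gamma> (X (nat \<gamma>) i)"
    using hole family_between[of i "nat \<gamma>" k] i nonneg unfolding hole_def by auto
  then obtain i' where i': "i' < n" "\<not> int i' < C" "X (nat \<gamma>) i = start i'"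
    unfolding hole_base by blast
  then have "birth i' = nat \<gamma>" using birth_cases[of i'] by auto
  then have "i = i'"
    using family_inj[of i "nat \<gamma>" i'] i i' family_start[of i' "nat \<gamma>"] by (auto simp: mem_act)
  then show False using i'(2) assms(2) by simp
qed

lemma family_avoids_hole_above:
  assumes "i \<in> act k" "k < birth i" "\<gamma> \<le> int k"
  shows "\<not> hole (int k) (X k i)"
  using assms birth_cases[of i] by (intro family_avoids_hole) auto

lemma family_avoids_hole_below:
  assumes "i \<in> act k" "\<gamma> < int k"
  shows "\<not> hole (int k) (X k i)"
  using assms birth_cases[of i] nonneg by (intro family_avoids_hole) (auto simp: mem_act)

text \<open>
  The triangle above an edge is missing from the region, while the one below is present, only on the
  top side and on the base of the puncture. All these edges are start edges, hence occupied.
\<close>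

lemma unoccupied_above_in_R:
  assumes "tri_below s k j \<in> R" "j \<notin> X (nat k) ` act (nat k)"
  shows "tri_above s k j \<in> R"
proof -
  have k: "0 < k" "k \<le> c" "cell k j" "\<not> (\<gamma> < k \<and> hole k j)"
    using assms(1) unfolding below_in_R by auto
  have "k \<noteq> c"
  proof
    assume "k = c"
    then obtain i where "i < n" "int i < C" "j = start i" using k cell_top by auto
    then have "i \<in> act (nat k)" "j = X (nat k) i"
      using \<open>k = c\<close> birth_cases[of i] family_top[of "nat k"] by (auto simp: mem_act)
    then show False using assms(2) by blast
  qed
  moreover have "\<not> (k = \<gamma> \<and> hole k j)"
  proof
    assume *: "k = \<gamma> \<and> hole k j"
    then obtain i where "i < n" "\<not> int i < C" "j = start i" using hole_base by auto
    then have "i \<in> act (nat k)" "j = X (nat k) i"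
      using * birth_cases[of i] family_start[of i "nat k"] by (auto simp: mem_act)
    then show False using assms(2) by blast
  qed
  ultimately show ?thesis using k unfolding above_in_R by auto
qed

text \<open>
  Dual to the previous lemma: above the start edge of a particle there is no triangle of the region, so
  a particle below such a triangle has come from the next higher level.
\<close>

lemma occupied_above_has_step:
  assumes "tri_above s (int k) (X k i) \<in> R" "i \<in> act k"
  shows "k < birth i"
proof (rule ccontr)
  assume "\<not> k < birth i"
  then have k: "birth i = k" "i < n" using assms(2) by (auto simp: mem_act)
  have R: "int k < c" "\<not> (\<gamma> \<le> int k \<and> hole (int k) (X k i))"
    using assms(1) unfolding above_in_R by auto
  then have "\<not> int i < C" "k = nat \<gamma>" using k birth_cases[of i] nonneg gamma_less by auto
  then have "hole \<gamma> (X k i)" unfolding hole_base using k family_start[of i k] by auto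
  then show False using R \<open>k = nat \<gamma>\<close> nonneg by simp
qed

text \<open>
  The triangle below an edge is matched along the step that leaves the edge, the triangle above it
  along the step that arrives there; if the edge is unoccupied, the two are matched with each other.
  Uniqueness of the partners is the absence of collisions.
\<close>

lemma tiling_of_in_tilings: "tiling_of X \<in> lozenge_tilings s R"
proof (rule lozenge_tilingsI)
  show "R \<subseteq> unit_triangles s" unfolding punctured_hexagon_def by blast
next
  fix L assume "L \<in> tiling_of X"
  then consider (step) i k where "L = loz s (int k + 1) (X (Suc k) i) (int k) (X k i)" "i < n" "k < birth i"
    | (flat) k j where "L = loz s k j k j" "tri_below s k j \<in> R" "j \<notin> X (nat k) ` act (nat k)"
    unfolding tiling_of_def by blast
  then show "\<exists>k j k' j'. L = loz s k j k' j' \<and> partner k j k' j' \<and>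
                 tri_below s k j \<in> R \<and> tri_above s k' j' \<in> R"
  proof cases
    case step
    have act: "i \<in> act (Suc k)" "i \<in> act k" using step by (auto simp: mem_act)
    have "int k < c" using step(3) birth_le[of i] by auto
    have "cell (int k + 1) (X (Suc k) i)" using family_cell[OF act(1)] by (simp add: add.commute)
    moreover have "\<not> (\<gamma> < int k + 1 \<and> hole (int k + 1) (X (Suc k) i))"
      using family_avoids_hole_below[OF act(1)] by (auto simp: add.commute)
    ultimately have "tri_below s (int k + 1) (X (Suc k) i) \<in> R"
      unfolding below_in_R using \<open>int k < c\<close> by simp
    moreover have "tri_above s (int k) (X k i) \<in> R"
      unfolding above_in_R
      using \<open>int k < c\<close> family_cell[OF act(2)] family_avoids_hole_above[OF act(2)] step(3) by simp
    moreover have "partner (int k + 1) (X (Suc k) i) (int k) (X k i)"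
      using family_step[OF step(2,3)] by (auto simp: partner_def)
    ultimately show ?thesis using step(1) by blast
  next
    case flat
    then show ?thesis using unoccupied_above_in_R by (auto simp: partner_def)
  qed
next
  fix k j assume R: "tri_below s k j \<in> R"
  show "\<exists>k' j'. loz s k j k' j' \<in> tiling_of X"
  proof (cases "j \<in> X (nat k) ` act (nat k)")
    case True
    then obtain i where i: "i \<in> act (nat k)" "j = X (nat k) i" by blast
    have "0 < k" using R unfolding below_in_R by simp
    then have "loz s k j (k - 1) (X (nat k - 1) i) \<in> tiling_of X"
      unfolding loz_in_tiling_of using i
      by (intro disjI1 exI[of _ i] exI[of _ "nat k - 1"]) (auto simp: mem_act)
    then show ?thesis by blast
  next
    case False
    then show ?thesis using R unfolding loz_in_tiling_of by blast
  qed
next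
  fix k j assume R: "tri_above s k j \<in> R"
  then have k: "0 \<le> k" "k < c" "cell k j" "\<not> (\<gamma> \<le> k \<and> hole k j)" unfolding above_in_R by auto
  show "\<exists>k' j'. loz s k' j' k j \<in> tiling_of X"
  proof (cases "j \<in> X (nat k) ` act (nat k)")
    case True
    then obtain i where i: "i \<in> act (nat k)" "j = X (nat k) i" by blast
    then have "nat k < birth i" using occupied_above_has_step[of "nat k" i] R k by simp
    then have "loz s (k + 1) (X (Suc (nat k)) i) k j \<in> tiling_of X"
      unfolding loz_in_tiling_of using i k
      by (intro disjI1 exI[of _ i] exI[of _ "nat k"]) (auto simp: mem_act)
    then show ?thesis by blast
  next
    case False
    have "k \<noteq> 0"
    proof
      assume "k = 0"
      then have "j \<in> X 0 ` {0..<n}" using k(3) cell_bottom X by (auto simp: families_def)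
      moreover have "act 0 = {0..<n}" by (auto simp: active_def)
      ultimately show False using False \<open>k = 0\<close> by simp
    qed
    then have "tri_below s k j \<in> R" using k unfolding below_in_R by auto
    then show ?thesis using False unfolding loz_in_tiling_of by blast
  qed
next
  fix k j k' j' l i
  assume "loz s k j k' j' \<in> tiling_of X" "loz s k j l i \<in> tiling_of X"
  then show "k' = l \<and> j' = i"
    unfolding loz_in_tiling_of
  proof (elim disjE exE conjE)
    fix p m q m'
    assume *: "p < n" "m < birth p" "k = int m + 1" "j = X (Suc m) p" "k' = int m" "j' = X m p"
      "q < n" "m' < birth q" "k = int m' + 1" "j = X (Suc m') q" "l = int m'" "i = X m' q"
    then have "m = m'" by simp
    moreover have "p = q" using * \<open>m = m'\<close> family_inj[of p "Suc m" q] by (auto simp: mem_act)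
    ultimately show ?thesis using * by simp
  qed (auto simp: mem_act nat_add_distrib)
next
  fix k j k' j' l i
  assume "loz s k j k' j' \<in> tiling_of X" "loz s l i k' j' \<in> tiling_of X"
  then show "k = l \<and> j = i"
    unfolding loz_in_tiling_of
  proof (elim disjE exE conjE)
    fix p m q m'
    assume *: "p < n" "m < birth p" "k = int m + 1" "j = X (Suc m) p" "k' = int m" "j' = X m p"
      "q < n" "m' < birth q" "l = int m' + 1" "i = X (Suc m') q" "k' = int m'" "j' = X m' q"
    then have "m = m'" by simp
    moreover have "p = q" using * \<open>m = m'\<close> family_inj[of p m q] by (auto simp: mem_act)
    ultimately show ?thesis using * by simp
  qed (auto simp: mem_act)
qed

end

text \<open>
  A family is read off its tiling from the top: the position of a particle determines the triangle below
  it, and the partner of this triangle determines the next position.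
\<close>

lemma inj_tiling_of: "inj_on tiling_of families"
proof (rule inj_onI)
  fix X X' assume X: "X \<in> families" and X': "X' \<in> families" and eq: "tiling_of X = tiling_of X'"
  have "X k = X' k" if "k \<le> nat c" for k
    using that
  proof (induction k rule: inc_induct)
    case base
    then show ?case using family_top[OF X] family_top[OF X'] by simp
  next
    case (step k)
    have ext: "X k \<in> extensional {0..<n}" "X' k \<in> extensional {0..<n}"
      using X X' step by (auto simp: families_def path_families_def moves_def PiE_def)
    show ?case
    proof (rule extensionalityI[OF ext])
      fix i assume "i \<in> {0..<n}"
      then have i: "i < n" by simp
      show "X k i = X' k i"
      proof (cases "k < birth i")
        case True
        have "loz s (int k + 1) (X (Suc k) i) (int k) (X k i) \<in> tiling_of X"
          "loz s (int k + 1) (X' (Suc k) i) (int k) (X' k i) \<in> tiling_of X'"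
          using True i unfolding loz_in_tiling_of by blast+
        then show ?thesis
          using tiling_loz_unique[OF tiling_of_in_tilings[OF X]] step unfolding eq by metis
      next
        case False
        then show ?thesis using family_start[OF X i] family_start[OF X' i] by simp
      qed
    qed
  qed
  moreover have "X k = X' k" if "nat c \<le> k" for k
    using family_top[OF X that] family_top[OF X' that] by simp
  ultimately show "X = X'" by (intro ext) (metis nat_le_linear)
qed

end

context punctured_hexagon_params
begin

text \<open>
  The edges of the line \<open>w = k\<close> that a path of \<open>T\<close> has to meet: those in the region that do not lie in the
  interior of a lozenge.
\<close>

definition occupied :: "triangle set set \<Rightarrow> nat \<Rightarrow> int set" where
  "occupied T k = {j. cell (int k) j \<and> \<not> (\<gamma> < int k \<and> hole (int k) j) \<and>
                      loz s (int k) j (int k) j \<notin> T}"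

lemma start_base_above_notin_R:
  assumes "i < n" "\<not> int i < C"
  shows "hole \<gamma> (start i)" "tri_above s \<gamma> (start i) \<notin> R"
proof -
  show "hole \<gamma> (start i)" using assms hole_base by blast
  then show "tri_above s \<gamma> (start i) \<notin> R" unfolding above_in_R by simp
qed

context
  fixes T
  assumes T: "T \<in> lozenge_tilings s R"
begin

text \<open>
  One step of all particles, along the lozenges of \<open>T\<close>. The description operator is meaningful only for
  particles on occupied edges; \<open>track_bij\<close> shows that they stay there.
\<close>

definition slide :: "nat \<Rightarrow> (nat \<Rightarrow> int) \<Rightarrow> nat \<Rightarrow> int" where
  "slide k x = (\<lambda>i \<in> {0..<n}. if k < birth i
      then THE j. loz s (int k + 1) (x i) (int k) j \<in> T else x i)"

text \<open>
  Recursion from level \<open>c\<close> downwards; the recursion variable is the depth \<open>c - k\<close>.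
\<close>

definition track :: "nat \<Rightarrow> nat \<Rightarrow> int" where
  "track k = rec_nat start (\<lambda>d. slide (nat c - Suc d)) (nat c - k)"

lemma track_top: "nat c \<le> k \<Longrightarrow> track k = start"
  by (simp add: track_def)

lemma track_slide:
  assumes "k < nat c"
  shows "track k = slide k (track (Suc k))"
proof -
  have "nat c - k = Suc (nat c - Suc k)" using assms by simp
  then show ?thesis using assms by (simp add: track_def)
qed

lemma track_rest:
  assumes "i < n" "birth i \<le> k"
  shows "track k i = start i"
proof (cases "k \<le> nat c")
  case True
  then show ?thesis using assms(2)
  proof (induction k rule: inc_induct)
    case base
    then show ?case by (simp add: track_top)
  next
    case (step l)
    then show ?case using assms(1) by (simp add: track_slide slide_def)
  qed
qed (simp add: track_top)

lemma track_follows: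
  assumes k: "k < birth i" "i < n" and occ: "track (Suc k) i \<in> occupied T (Suc k)"
  shows "loz s (int k + 1) (track (Suc k) i) (int k) (track k i) \<in> T"
proof -
  let ?j = "track (Suc k) i"
  have kc: "k < nat c" using k birth_le[of i] by simp
  have occ': "cell (int k + 1) ?j" "\<not> (\<gamma> < int k + 1 \<and> hole (int k + 1) ?j)"
    "loz s (int k + 1) ?j (int k + 1) ?j \<notin> T"
    using occ by (auto simp: occupied_def add.commute)
  have "tri_below s (int k + 1) ?j \<in> R"
    unfolding below_in_R using kc occ' by auto
  then obtain k' j' where j': "loz s (int k + 1) ?j k' j' \<in> T" "partner (int k + 1) ?j k' j'"
    by (rule tiling_below_cover[OF T])
  then have "k' = int k" using occ'(3) by (auto simp: partner_def)
  then have "loz s (int k + 1) ?j (int k) j' \<in> T" using j' by simp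
  moreover have "(THE j. loz s (int k + 1) ?j (int k) j \<in> T) = j'"
    using calculation tiling_loz_unique[OF T] by (intro the_equality) blast+
  ultimately show ?thesis
    using k kc by (simp add: track_slide slide_def)
qed

text \<open>
  The heart of the converse direction: the particles on each line sit exactly on the edges that have no
  lozenge of \<open>T\<close> astride them. For the step from level \<open>k + 1\<close> to \<open>k\<close>, an occupied edge of level
  \<open>k\<close> either has a triangle of the region above it, whose partner then lies below an occupied edge of
  level \<open>k + 1\<close>, or it is a start edge on the base of the puncture. These two cases separate the
  particles that have just moved from those that enter at level \<open>k\<close>, which also gives injectivity.
\<close>

lemma track_bij: "k \<le> nat c \<Longrightarrow> bij_betw (track k) (act k) (occupied T k)"
proof (induction k rule: inc_induct)
  case base
  have c: "int (nat c) = c" using gamma_less nonneg by simp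
  have birth_c: "nat c \<le> birth i \<longleftrightarrow> int i < C" for i
    using birth_cases[of i] gamma_less nonneg by auto
  have "birth i = nat c \<and> i < n" if "i \<in> act (nat c)" for i
    using that birth_le[of i] by (simp add: mem_act)
  then have "inj_on start (act (nat c))"
    using inj_start_same_birth unfolding inj_on_def by metis
  moreover have "start ` act (nat c) = {j. cell c j}"
    unfolding cell_top image_def mem_act Bex_def birth_c by blast
  moreover have "occupied T (nat c) = {j. cell c j}"
  proof -
    have "loz s c j c j \<notin> T" for j
      using tiling_lozD(3)[OF T, of c j c j] unfolding above_in_R by blast
    then show ?thesis
      using no_hole_top unfolding occupied_def c by blast
  qed
  ultimately show ?case unfolding bij_betw_def by (simp add: track_top)
next
  case (step k)
  have kc: "int k < c" using step by simp
  have follow: "loz s (int k + 1) (track (Suc k) i) (int k) (track k i) \<in> T"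
    if "i < n" "k < birth i" for i
    using that bij_betw_apply[OF step.IH, of i] by (intro track_follows) (simp_all add: mem_act)
  have rest: "\<not> int i < C \<and> int k = \<gamma> \<and> track k i = start i"
    if "i < n" "k \<le> birth i" "\<not> k < birth i" for i
    using that kc birth_cases[of i] track_rest[of i k] nonneg by auto
  have above: "k < birth i \<longleftrightarrow> tri_above s (int k) (track k i) \<in> R" if "i < n" "k \<le> birth i" for i
  proof
    assume "k < birth i"
    then show "tri_above s (int k) (track k i) \<in> R" using tiling_lozD(3)[OF T follow] that(1) by blast
  next
    assume "tri_above s (int k) (track k i) \<in> R"
    then show "k < birth i" using rest[OF that] start_base_above_notin_R(2)[OF that(1)] by metis
  qed
  have inj: "inj_on (track k) (act k)"
  proof (rule inj_onI)
    fix i i' assume "i \<in> act k" "i' \<in> act k" and eq: "track k i = track k i'"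
    then have i: "i < n" "k \<le> birth i" "i' < n" "k \<le> birth i'" by (auto simp: mem_act)
    show "i = i'"
    proof (cases "k < birth i")
      case True
      then have True': "k < birth i'" using above[OF i(1,2)] above[OF i(3,4)] eq by simp
      have "track (Suc k) i = track (Suc k) i'"
        using tiling_loz_unique[OF T follow[OF i(1) True] follow[OF i(3) True']] eq by simp
      then show ?thesis
        using inj_onD[OF bij_betw_imp_inj_on[OF step.IH], of i i'] True True' i by (simp add: mem_act)
    next
      case False
      then have "\<not> k < birth i'" using above[OF i(1,2)] above[OF i(3,4)] eq by simp
      then have "birth i = k" "birth i' = k" using False i by simp_all
      moreover from this have "start i = start i'"
        using eq track_rest[of i k] track_rest[of i' k] i by simp
      ultimately show ?thesis using inj_start_same_birth[OF i(1,3)] by simp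
    qed
  qed
  have into: "track k i \<in> occupied T k" if "i \<in> act k" for i
  proof -
    have i: "i < n" "k \<le> birth i" using that by (auto simp: mem_act)
    show ?thesis
    proof (cases "k < birth i")
      case True
      have "tri_above s (int k) (track k i) \<in> R" using above True i by blast
      moreover have "loz s (int k) (track k i) (int k) (track k i) \<notin> T"
        using tiling_loz_unique[OF T follow[OF i(1) True], of "int k" "track k i" "int k" "track k i"]
        by auto
      ultimately show ?thesis unfolding occupied_def above_in_R by auto
    next
      case False
      then have "\<not> int i < C" "int k = \<gamma>" "track k i = start i" using rest[OF i] by auto
      moreover from this have "hole \<gamma> (start i)" "tri_above s \<gamma> (start i) \<notin> R"
        using start_base_above_notin_R[OF i(1)] by auto
      ultimately show ?thesis
        using cell_hole_base tiling_lozD(3)[OF T] unfolding occupied_def by auto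
    qed
  qed
  have onto: "j \<in> track k ` act k" if "j \<in> occupied T k" for j
  proof (cases "tri_above s (int k) j \<in> R")
    case True
    then obtain l i where l: "loz s l i (int k) j \<in> T" "partner l i (int k) j"
      by (rule tiling_above_cover[OF T])
    then have lk: "l = int k + 1" using that by (auto simp: partner_def occupied_def)
    have R: "tri_below s (int k + 1) i \<in> R" using tiling_lozD(2)[OF T l(1)] lk by simp
    have "loz s (int k + 1) i (int k + 1) i \<notin> T"
      using tiling_loz_unique[OF T l(1), of "int k + 1" i "int k + 1" i] lk by auto
    then have "i \<in> occupied T (Suc k)"
      using R unfolding below_in_R occupied_def by (auto simp: add.commute)
    then have "i \<in> track (Suc k) ` act (Suc k)"
      using step.IH by (simp add: bij_betw_def)
    then obtain m where m: "m < n" "k < birth m" "i = track (Suc k) m"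
      by (auto simp: mem_act)
    have "j = track k m"
      using tiling_loz_unique[OF T l(1) follow[OF m(1,2)]] m(3) lk by simp
    then show ?thesis using m by (auto simp: mem_act)
  next
    case False
    then have "int k = \<gamma>" "hole \<gamma> j"
      using that kc unfolding above_in_R occupied_def by auto
    then obtain i where i: "i < n" "\<not> int i < C" "j = start i" using hole_base by auto
    then have "birth i = k" using birth_cases[of i] \<open>int k = \<gamma>\<close> by auto
    then have "i \<in> act k" "j = track k i" using i track_rest[of i k] by (simp_all add: mem_act)
    then show ?thesis by blast
  qed
  show ?case
    unfolding bij_betw_def using inj into onto by auto
qed

lemma track_step:
  assumes "i < n" "k < birth i"
  shows "loz s (int k + 1) (track (Suc k) i) (int k) (track k i) \<in> T"
proof -
  have "Suc k \<le> nat c" using assms birth_le[of i] by simp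
  then show ?thesis
    using bij_betw_apply[OF track_bij, of "Suc k" i] assms by (intro track_follows) (simp_all add: mem_act)
qed

lemma track_in_families: "track \<in> families"
proof -
  have "track k \<in> moves n birth (Suc k) (track (Suc k))" if "k < nat c" for k
    unfolding moves_def
  proof (rule PiE_I)
    fix i assume "i \<in> {0..<n}"
    then have i: "i < n" by simp
    show "track k i \<in> (if Suc k \<le> birth i then {track (Suc k) i, track (Suc k) i + 1} else {track (Suc k) i})"
    proof (cases "k < birth i")
      case True
      then show ?thesis
        using tiling_lozD(1)[OF T track_step[OF i True]] by (auto simp: partner_def)
    next
      case False
      then show ?thesis using that i by (simp add: track_slide slide_def)
    qed
  next
    fix i assume "i \<notin> {0..<n}"
    then show "track k i = undefined" using that by (simp add: track_slide slide_def)
  qed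
  moreover have "inj_on (track k) (act k)" if "k < nat c" for k
    using track_bij[of k] that by (simp add: bij_betw_def)
  moreover have "track 0 ` {0..<n} = target ` {0..<n}"
  proof -
    have "act 0 = {0..<n}" by (auto simp: active_def)
    then have "track 0 ` {0..<n} = occupied T 0" using track_bij[of 0] by (simp add: bij_betw_def)
    also have "\<dots> = {j. cell 0 j}"
      using tiling_lozD(2)[OF T, of 0 _ 0] nonneg unfolding occupied_def below_in_R by auto
    finally show ?thesis using cell_bottom by blast
  qed
  ultimately show ?thesis
    unfolding families_def path_families_def by (simp add: track_top)
qed

lemma tiling_of_track: "tiling_of track = T"
proof (rule partition_on_subset_eq)
  show "partition_on R (tiling_of track)" "partition_on R T"
    using tiling_of_in_tilings[OF track_in_families] T by (auto simp: lozenge_tilings_def)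
  have flat: "loz s k j k j \<in> T" if "tri_below s k j \<in> R" "j \<notin> track (nat k) ` act (nat k)" for k j
  proof -
    have k: "0 < k" "k \<le> c" "cell k j" "\<not> (\<gamma> < k \<and> hole k j)"
      using that(1) unfolding below_in_R by auto
    then have "j \<notin> occupied T (nat k)"
      using track_bij[of "nat k"] that(2) by (auto simp: bij_betw_def)
    then show ?thesis using k by (auto simp: occupied_def)
  qed
  show "tiling_of track \<subseteq> T"
    unfolding tiling_of_def using flat track_step by blast
qed

end

lemma bij_tiling_of: "bij_betw tiling_of families (lozenge_tilings s R)"
  unfolding bij_betw_def
proof (intro conjI inj_tiling_of equalityI subsetI)
  fix T assume "T \<in> tiling_of ` families"
  then show "T \<in> lozenge_tilings s R" using tiling_of_in_tilings by blast
next
  fix T assume "T \<in> lozenge_tilings s R"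
  then show "T \<in> tiling_of ` families"
    using track_in_families tiling_of_track by (metis imageI)
qed

section \<open>The sign of a tiling\<close>

lemma start_edge_eq: "i < n \<Longrightarrow> start_edge s c \<beta> \<gamma> C (Suc i) = w_edge s (int (birth i)) (start i)"
  using nonneg gamma_less start_left[of i] start_right[of i]
  by (auto simp: start_edge_def birth_def algebra_simps)

lemma end_edge_eq: "end_edge s A (Suc i) = w_edge s 0 (target i)"
  by (simp add: end_edge_def target_def algebra_simps)

context
  fixes X
  assumes X: "X \<in> families"
begin

lemma path_steps_tiling_of:
  "(e, e') \<in> path_steps (tiling_of X) \<longleftrightarrow>
     (\<exists>i k. i < n \<and> k < birth i \<and>
       (e = w_edge s (int k + 1) (X (Suc k) i) \<and> e' = w_edge s (int k) (X k i) \<or>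
        e = w_edge s (int k) (X k i) \<and> e' = w_edge s (int k + 1) (X (Suc k) i)))"
proof -
  have sub: "tiling_of X \<subseteq> lozenges s"
    using tiling_of_in_tilings[OF X] by (auto simp: lozenge_tilings_def)
  have "loz s k j (k - 1) j' \<in> tiling_of X \<longleftrightarrow>
     (\<exists>i l. i < n \<and> l < birth i \<and> k = int l + 1 \<and> j = X (Suc l) i \<and> j' = X l i)" for k j j'
    unfolding loz_in_tiling_of by auto
  then show ?thesis
    unfolding path_steps_iff[OF sub] by fastforce
qed

lemma path_reaches:
  assumes "i < n" "k \<le> birth i"
  shows "(w_edge s (int (birth i)) (start i), w_edge s (int k) (X k i)) \<in> (path_steps (tiling_of X))\<^sup>*"
  using assms(2)
proof (induction k rule: inc_induct)
  case base
  then show ?case using family_start[OF X assms(1)] by simp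
next
  case (step k)
  have "(w_edge s (int k + 1) (X (Suc k) i), w_edge s (int k) (X k i)) \<in> path_steps (tiling_of X)"
    unfolding path_steps_tiling_of using assms(1) step by blast
  with step.IH show ?case by (simp add: add.commute rtrancl.rtrancl_into_rtrancl)
qed

text \<open>
  All edges of a path belong to the same particle because particles never meet; the relation
  \<open>path_steps\<close> is symmetric, so steps in both directions have to be considered.
\<close>

lemma path_component:
  assumes "i < n" "(w_edge s (int (birth i)) (start i), e) \<in> (path_steps (tiling_of X))\<^sup>*"
  shows "\<exists>k \<le> birth i. e = w_edge s (int k) (X k i)"
  using assms(2)
proof (induction rule: rtrancl_induct)
  case base
  then show ?case using family_start[OF X assms(1)] by auto
next
  case (step e e')
  then obtain k where k: "k \<le> birth i" "e = w_edge s (int k) (X k i)" by blast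
  obtain i' l where l: "i' < n" "l < birth i'"
    "e = w_edge s (int l + 1) (X (Suc l) i') \<and> e' = w_edge s (int l) (X l i') \<or>
     e = w_edge s (int l) (X l i') \<and> e' = w_edge s (int l + 1) (X (Suc l) i')"
    using step(2) unfolding path_steps_tiling_of by blast
  from l(3) show ?case
  proof (elim disjE conjE)
    assume e: "e = w_edge s (int l + 1) (X (Suc l) i')" "e' = w_edge s (int l) (X l i')"
    then have kl: "k = Suc l" using k by simp
    then have "X k i = X k i'" using e k by simp
    then have "i = i'" using family_inj[OF X, of i k i'] assms(1) k l kl by (auto simp: mem_act)
    then show ?thesis using e l by (auto intro: exI[of _ l])
  next
    assume e: "e = w_edge s (int l) (X l i')" "e' = w_edge s (int l + 1) (X (Suc l) i')"
    then have "k = l" "X k i = X k i'" using k by auto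
    then have "i = i'" using family_inj[OF X, of i k i'] assms(1) k l by (auto simp: mem_act)
    then show ?thesis using e l by (auto intro: exI[of _ "Suc l"] simp: add.commute)
  qed
qed

text \<open>
  Path \<open>i\<close> reaches the end edge of \<open>p i\<close>, and by \<open>path_component\<close> no other edge of the bottom line. The
  conjugation by \<open>Suc\<close> passes from particles numbered from \<open>0\<close> to end points numbered from \<open>1\<close>.
\<close>

lemma path_permutation_tiling_of:
  assumes p: "p permutes {0..<n}" and Xp: "\<And>i. i < n \<Longrightarrow> X 0 i = target (p i)"
  shows "path_permutation n (start_edge s c \<beta> \<gamma> C) (end_edge s A) (tiling_of X)
           = map_permutation {0..<n} Suc p"
proof -
  let ?q = "map_permutation {0..<n} Suc p"
  have Suc_bij: "bij_betw Suc {0..<n} {1..n}"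
    by (simp add: bij_betw_def image_Suc_atLeastLessThan atLeastLessThanSuc_atLeastAtMost)
  have q: "?q permutes {1..n}" by (rule map_permutation_permutes[OF Suc_bij p])
  have q_Suc: "?q (Suc i) = Suc (p i)" if "i < n" for i
    using that by (simp add: map_permutation_apply)
  have Suc_iff: "(\<forall>m \<in> {1..n}. P m) \<longleftrightarrow> (\<forall>i < n. P (Suc i))" for P
    using Suc_bij unfolding bij_betw_def by (metis atLeastLessThan_iff image_iff zero_le)
  show ?thesis
    unfolding path_permutation_def Suc_iff
  proof (rule the_equality)
    show "?q permutes {1..n} \<and>
        (\<forall>i<n. (start_edge s c \<beta> \<gamma> C (Suc i), end_edge s A (?q (Suc i))) \<in> (path_steps (tiling_of X))\<^sup>*)"
      using q path_reaches[of _ 0] by (simp add: q_Suc start_edge_eq end_edge_eq Xp)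
  next
    fix r
    assume r: "r permutes {1..n} \<and>
        (\<forall>i<n. (start_edge s c \<beta> \<gamma> C (Suc i), end_edge s A (r (Suc i))) \<in> (path_steps (tiling_of X))\<^sup>*)"
    have r_Suc: "r (Suc i) = Suc (p i)" if "i < n" for i
    proof -
      have "r (Suc i) \<in> {1..n}" using r that permutes_in_image[of r "{1..n}" "Suc i"] by simp
      then obtain m where m: "r (Suc i) = Suc m" by (cases "r (Suc i)") auto
      have "(w_edge s (int (birth i)) (start i), w_edge s 0 (target m)) \<in> (path_steps (tiling_of X))\<^sup>*"
        using r that m by (metis start_edge_eq end_edge_eq)
      then have "target m = X 0 i" using path_component[OF that] by fastforce
      then show ?thesis using Xp[OF that] m by (simp add: target_def)
    qed
    show "r = ?q"
    proof
      fix m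
      show "r m = ?q m"
      proof (cases "m \<in> {1..n}")
        case True
        then obtain i where "m = Suc i" "i < n" by (cases m) auto
        then show ?thesis using r_Suc q_Suc by simp
      next
        case False
        then show ?thesis using r q by (metis permutes_not_in)
      qed
    qed
  qed
qed

lemma sign_tiling_of:
  "sign (path_permutation n (start_edge s c \<beta> \<gamma> C) (end_edge s A) (tiling_of X))
     = det (binom_mat n birth target 0 (X 0))"
proof -
  have "inj_on (X 0) {0..<n}"
    using family_inj[OF X, of _ 0] by (auto simp: inj_on_def mem_act)
  then have bij: "bij_betw (X 0) {0..<n} (target ` {0..<n})"
    using X by (simp add: bij_betw_def families_def)
  define p where "p = restrict_id (inv_into {0..<n} target \<circ> X 0) {0..<n}"
  have p: "p permutes {0..<n}"
    unfolding p_def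
    by (intro permutes_restrict_id bij_betw_trans[OF bij] bij_betw_inv_into inj_on_imp_bij_betw inj_target)
  have Xp: "X 0 i = target (p i)" if "i < n" for i
    using bij_betw_apply[OF bij, of i] that by (simp add: p_def f_inv_into_f)
  show ?thesis
    using path_permutation_tiling_of[OF p Xp] det_binom_mat_0_permutation[OF p inj_target Xp] p
    by (simp add: sign_map_permutation)
qed

end

lemma N_matrix_eq: "N_matrix c \<beta> \<gamma> A C M = binom_mat n birth target (nat c) start"
proof (rule eq_matI)
  fix i j assume "i < dim_row (binom_mat n birth target (nat c) start)"
    "j < dim_col (binom_mat n birth target (nat c) start)"
  then have "i < n" "j < n" by (simp_all add: binom_mat_def)
  then show "N_matrix c \<beta> \<gamma> A C M $$ (i, j) = binom_mat n birth target (nat c) start $$ (i, j)"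
  proof (cases "int i < C")
    case True
    have "A + (int j + 1) - (int i + 1) = target j - start i"
      using start_left[OF \<open>i < n\<close> True] by (simp add: target_def)
    then show ?thesis
      using True \<open>i < n\<close> \<open>j < n\<close> birth_cases[of i] gamma_less nonneg
      by (simp add: N_matrix_def binom_mat_def Let_def)
  next
    case False
    have "A + C - \<beta> + (int j + 1) - (int i + 1) = target j - start i"
      using start_right[OF \<open>i < n\<close> False] by (simp add: target_def)
    then show ?thesis
      using False \<open>i < n\<close> \<open>j < n\<close> birth_cases[of i] gamma_less nonneg
      by (simp add: N_matrix_def binom_mat_def Let_def min_absorb2)
  qed
qed (simp_all add: N_matrix_def binom_mat_def)

lemma signed_tilings_eq_det:
  "(\<Sum>T \<in> lozenge_tilings s R. sign (path_permutation n (start_edge s c \<beta> \<gamma> C) (end_edge s A) T))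
     = det (N_matrix c \<beta> \<gamma> A C M)"
proof -
  note expansion = det_binom_mat_expansion[of n birth "nat c" start target]
  have missed: "det (binom_mat n birth target 0 (X 0)) = 0"
    if X: "X \<in> path_families n birth (nat c) start" "X \<notin> families" for X
  proof -
    have "inj_on (X 0) (act 0)" using X(1) gamma_less nonneg by (auto simp: path_families_def)
    then have "inj_on (X 0) {0..<n}" by (auto simp: inj_on_def mem_act)
    then have "card (X 0 ` {0..<n}) = card (target ` {0..<n})"
      using inj_target by (simp add: card_image)
    moreover have "X 0 ` {0..<n} \<noteq> target ` {0..<n}" using X by (simp add: families_def)
    ultimately have "\<not> X 0 ` {0..<n} \<subseteq> target ` {0..<n}"
      by (metis card_subset_eq finite_imageI finite_atLeastLessThan)
    then obtain i where "i < n" "X 0 i \<notin> target ` {0..<n}" by fastforce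
    then show ?thesis by (rule det_binom_mat_0_missed)
  qed
  have "(\<Sum>T \<in> lozenge_tilings s R. sign (path_permutation n (start_edge s c \<beta> \<gamma> C) (end_edge s A) T))
      = (\<Sum>X \<in> families. sign (path_permutation n (start_edge s c \<beta> \<gamma> C) (end_edge s A) (tiling_of X)))"
    by (rule sum.reindex_bij_betw[OF bij_tiling_of, symmetric])
  also have "\<dots> = (\<Sum>X \<in> families. det (binom_mat n birth target 0 (X 0)))"
    by (intro sum.cong sign_tiling_of) simp_all
  also have "\<dots> = (\<Sum>X \<in> path_families n birth (nat c) start. det (binom_mat n birth target 0 (X 0)))"
    using expansion missed by (intro sum.mono_neutral_left) (auto simp: families_def)
  also have "\<dots> = det (N_matrix c \<beta> \<gamma> A C M)"
    using expansion N_matrix_eq by simp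
  finally show ?thesis .
qed

end

theorem theorem4p5:
  fixes a b c \<alpha> \<beta> \<gamma> s A B C M :: int
  assumes "0 \<le> \<alpha>" "\<alpha> < a" and "0 \<le> \<beta>" "\<beta> < b" and "0 \<le> \<gamma>" "\<gamma> < c"
    and "\<not> (\<alpha> = 0 \<and> \<beta> = 0)" "\<not> (\<alpha> = 0 \<and> \<gamma> = 0)" "\<not> (\<beta> = 0 \<and> \<gamma> = 0)"
    and "(a + b + c + \<alpha> + \<beta> + \<gamma>) mod 3 = 0"
    and "s = (a + b + c + \<alpha> + \<beta> + \<gamma>) div 3 - 2"
    and "A = s + 2 - a" and "B = s + 2 - b" and "C = s + 2 - c"
    and "M = s + 2 - (\<alpha> + \<beta> + \<gamma>)"
    and "0 \<le> M"
    and "0 \<le> A" "A \<le> \<beta> + \<gamma>" and "0 \<le> B" "B \<le> \<alpha> + \<gamma>" and "0 \<le> C" "C \<le> \<alpha> + \<beta>"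
  shows "(\<Sum>T \<in> lozenge_tilings s (punctured_hexagon s a b c \<alpha> \<beta> \<gamma>).
            sign (path_permutation (nat (C + M))
                    (start_edge s c \<beta> \<gamma> C) (end_edge s A) T))
         = det (N_matrix c \<beta> \<gamma> A C M)"
proof -
  have "a + b + c + \<alpha> + \<beta> + \<gamma> = 3 * (s + 2)"
    using assms(10,11) by presburger
  then interpret punctured_hexagon_params a b c \<alpha> \<beta> \<gamma> s A B C M
    using assms by unfold_locales
  show ?thesis by (rule signed_tilings_eq_det)
qed

end
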